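(* Let $g:X\to[0,1]$ be a $g$-function on $X=A^{-\mathbb N}$ ($A$ a finite alphabet) and let $\mathcal D\subset X$ be its set of discontinuity points. Assume that (i) there exist $N\in\mathbb N$ and $\varepsilon>0$ such that $\inf_{\mathcal E_N} g=\varepsilon$; (ii) $P_g(\mathcal D)<0$. Then there exists at least one $g$-measure $\mu$, and $\mu$ is carried by $X\setminus\mathcal D$, i.e. $\mu(\mathcal D)=0$.
   Context: $A$ is a finite set and $\mathbb N=\{0,1,2,\dots\}$. $X=A^{-\mathbb N}$ is the set of sequences $x=(x_{-i})_{i\in\mathbb N}=\dots x_{-1}x_0$, with the product of the discrete topologies and the $\sigma$-algebra $\mathcal F$ generated by the coordinates. For $x\in X$, $a\in A$, $xa\in X$ is the sequence $\dots x_{-1}x_0a$ (last coordinate $a$). $T:X\to X$ is the shift $(x_n)_{n\le0}\mapsto(x_{n-1})_{n\le 0}$, so $T(xa)=x$. A $g$-function is an $\mathcal F$-measurable $g:X\to[0,1]$ with $\sum_{a\in A}g(xa)=1$ for all $x\in X$. A $g$-measure is a Borel probability measure $\mu$ on $X$ that is $T$-invariant and such that for $\mu$-a.e. $x$ and every $a\in A$, $\mathbb E_\mu(\mathbf 1_{\{x_0=a\}}\mid T^{-1}\mathcal F)(x)=g(T(x)a)$. $\mathcal D$ is the set of points of $X$ at which $g$ is not continuous (for the product topology). Cylinders: $C_n(x)=\{w\in X: w_{-n+1}^0=x_{-n+1}^0\}$, where $x_{-n+1}^0=(x_{-n+1},\dots,x_0)$; $\mathcal C_n=\{C_n(x):x\in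 X\}$; $\mathcal C_n(\mathcal D)=\bigcup_{x\in\mathcal D}C_n(x)$. For $n\in\mathbb N$, $\mathcal E_n=T^{-1}\big(T(\mathcal C_{n+1}(\mathcal D))\big)$; i.e. $\mathcal E_n$ is the set of points $y x_{-n}\cdots x_{-1}a$ with $a\in A$, $x\in\mathcal D$, $y\in X$. For $n\ge1$, $g_n(x)=\prod_{i=0}^{n-1}g(T^i(x))$. The topological pressure of a measurable $S\subset X$ is $$P_g(S)=\limsup_{n\to\infty}\frac1n\log\sum_{B\in\mathcal C_n,\ B\cap S\ne\emptyset}\ \sup_B g_n\in[-\infty,\infty),$$ with $\log 0=-\infty$. *)

theory Defs
  imports "HOL-Probability.Probability"
begin

text \<open>
  The alphabet is the type \<^typ>\<open>'a::finite\<close>. A left-infinite sequence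
  \<open>\<dots> x\<^bsub>-1\<^esub> x\<^sub>0\<close> is a function \<^typ>\<open>nat \<Rightarrow> 'a\<close> whose value at \<open>i\<close> is the
  coordinate \<open>x\<^bsub>-i\<^esub>\<close>, so the most recent symbol sits at index \<open>0\<close>.
\<close>

type_synonym 'a past = "nat \<Rightarrow> 'a"

definition append_symbol :: "'a past \<Rightarrow> 'a \<Rightarrow> 'a past" where
  "append_symbol x a = case_nat a x"

definition shift :: "'a past \<Rightarrow> 'a past" where
  "shift x = (\<lambda>i. x (Suc i))"

definition past_algebra :: "'a past measure" where
  "past_algebra = (\<Pi>\<^sub>M i\<in>UNIV. count_space UNIV)"

definition past_topology :: "'a past topology" where
  "past_topology = product_topology (\<lambda>_. discrete_topology UNIV) UNIV"

definition g_function :: "('a::finite past \<Rightarrow> real) \<Rightarrow> bool" where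
  "g_function g \<longleftrightarrow>
     g \<in> borel_measurable past_algebra \<and>
     (\<forall>x. 0 \<le> g x \<and> g x \<le> 1) \<and>
     (\<forall>x. (\<Sum>a\<in>UNIV. g (append_symbol x a)) = 1)"

text \<open>
  For a finite alphabet the product \<open>\<sigma>\<close>-algebra is the Borel \<open>\<sigma>\<close>-algebra of the
  product topology. \<^const>\<open>vimage_algebra\<close> below is the \<open>\<sigma>\<close>-algebra \<open>T\<^sup>-\<^sup>1 \<F>\<close>.
\<close>

definition g_measure :: "('a::finite past \<Rightarrow> real) \<Rightarrow> 'a past measure \<Rightarrow> bool" where
  "g_measure g \<mu> \<longleftrightarrow>
     prob_space \<mu> \<and> sets \<mu> = sets past_algebra \<and>
     distr \<mu> past_algebra shift = \<mu> \<and>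
     (AE x in \<mu>. \<forall>a. real_cond_exp \<mu> (vimage_algebra UNIV shift past_algebra)
                        (indicator {y. y 0 = a}) x
                      = g (append_symbol (shift x) a))"

definition discontinuities :: "('a past \<Rightarrow> real) \<Rightarrow> 'a past set" where
  "discontinuities g = {x. \<not> topcontinuous_at past_topology euclideanreal g x}"

definition cylinder :: "nat \<Rightarrow> 'a past \<Rightarrow> 'a past set" where
  "cylinder n x = {w. \<forall>i<n. w i = x i}"

definition cylinders :: "nat \<Rightarrow> 'a past set set" where
  "cylinders n = range (cylinder n)"

definition cylinder_hull :: "nat \<Rightarrow> 'a past set \<Rightarrow> 'a past set" where
  "cylinder_hull n S = (\<Union>x\<in>S. cylinder n x)"

definition E_set :: "('a past \<Rightarrow> real) \<Rightarrow> nat \<Rightarrow> 'a past set" where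
  "E_set g n = shift -` (shift ` cylinder_hull (Suc n) (discontinuities g))"

definition g_prod :: "('a past \<Rightarrow> real) \<Rightarrow> nat \<Rightarrow> 'a past \<Rightarrow> real" where
  "g_prod g n x = (\<Prod>i<n. g ((shift ^^ i) x))"

text \<open>The library logarithm satisfies \<open>ln 0 = 0\<close>; the pressure needs \<open>log 0 = -\<infinity>\<close>.
  Only nonnegative arguments occur.\<close>

definition ext_log :: "real \<Rightarrow> ereal" where
  "ext_log s = (if s = 0 then -\<infinity> else ereal (ln s))"

definition pressure :: "('a::finite past \<Rightarrow> real) \<Rightarrow> 'a past set \<Rightarrow> ereal" where
  "pressure g S =
     limsup (\<lambda>n. ereal (1 / real n) *
       ext_log (\<Sum>B\<in>{B \<in> cylinders n. B \<inter> S \<noteq> {}}. SUP x\<in>B. g_prod g n x))"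

end

theory Submission
  imports Defs "HOL-Complex_Analysis.Great_Picard"
begin

text \<open>
  Let \<open>L f x = (\<Sum>a. g (xa) * f (xa))\<close> be the transfer operator, so \<open>L 1 = 1\<close>. Along a subsequence the
  Cesaro means of \<open>L\<^sup>k f x\<^sub>0\<close> converge for every clopen indicator \<open>f\<close>; the limit extends to a
  probability measure \<open>\<mu>\<close>. If \<open>H\<^sub>n\<close> is the union of the \<open>n\<close>-cylinders meeting the discontinuity set \<open>D\<close>,
  then \<open>L\<^sup>n 1\<^bsub>H\<^sub>n\<^esub>\<close> is at most the \<open>n\<close>-th pressure sum, uniformly, hence \<open>\<mu> H\<^sub>n \<longlonglongrightarrow> 0\<close> and \<open>\<mu> D = 0\<close>.
  The only obstruction to \<open>L\<close>-invariance of \<open>\<mu>\<close> is that \<open>L f\<close> may be discontinuous on the shifted set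
  \<open>T D\<close>, which may be much larger than \<open>D\<close> in measure where \<open>g\<close> is small; the lower bound \<open>e\<close> of \<open>g\<close> near \<open>D\<close>
  gives \<open>1\<^bsub>T H\<^sub>n\<^esub> \<le> L 1\<^bsub>H\<^sub>n\<^esub> / e\<close>, so \<open>T H\<^sub>n\<close> also has vanishing mass, and off the clopen set \<open>T H\<^sub>n\<close> the
  function \<open>L f\<close> is a uniform limit of cylindrical functions. Finally \<open>L\<close>-invariance of \<open>\<mu>\<close> is the
  property of being a \<open>g\<close>-measure.
\<close>

subsection \<open>Cylindrical sets\<close>

definition cylindrical :: "nat \<Rightarrow> 'a past set \<Rightarrow> bool" where
  "cylindrical n A \<longleftrightarrow> (\<forall>x\<in>A. cylinder n x \<subseteq> A)"

text \<open>Over a finite alphabet these are exactly the clopen sets. They form a countable algebra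
  generating the sigma-algebra, and the limit measure is first defined on them.\<close>

definition cylindrical_sets :: "'a past set set" where
  "cylindrical_sets = {A. \<exists>n. cylindrical n A}"

lemma mem_cylinder_self [simp]: "x \<in> cylinder n x"
  by (simp add: cylinder_def)

lemma mem_cylinder_sym: "w \<in> cylinder n x \<longleftrightarrow> x \<in> cylinder n w"
  by (auto simp: cylinder_def)

lemma cylinder_antimono: "m \<le> n \<Longrightarrow> cylinder n x \<subseteq> cylinder m x"
  by (auto simp: cylinder_def)

lemma cylinder_eq: "w \<in> cylinder n x \<Longrightarrow> cylinder n w = cylinder n x"
  by (auto simp: cylinder_def)

lemma mem_cylinder_append:
  "w \<in> cylinder n x \<Longrightarrow> append_symbol w a \<in> cylinder (Suc n) (append_symbol x a)"
  by (auto simp: cylinder_def append_symbol_def split: nat.split)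

lemma shift_append [simp]: "shift (append_symbol x a) = x"
  by (simp add: shift_def append_symbol_def)

lemma append_symbol_0 [simp]: "append_symbol x a 0 = a"
  by (simp add: append_symbol_def)

lemma append_shift: "append_symbol (shift x) (x 0) = x"
  by (auto simp: shift_def append_symbol_def fun_eq_iff split: nat.split)

text \<open>A cylinder does not change when its centre is restricted to the indices below
  \<open>n\<close>, and a finite alphabet allows only finitely many such restrictions.\<close>

lemma finite_cylinders: "finite (cylinders n :: 'a::finite past set set)"
proof (rule finite_surj)
  show "finite (PiE {..<n} (\<lambda>_. UNIV :: 'a set))" by (simp add: finite_PiE)
  show "cylinders n \<subseteq> cylinder n ` (PiE {..<n} (\<lambda>_. UNIV :: 'a set))"
    unfolding cylinders_def
  proof (rule image_subsetI)
    fix x :: "'a past"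
    have "cylinder n x = cylinder n (restrict x {..<n})"
      by (simp add: cylinder_def)
    then show "cylinder n x \<in> cylinder n ` (PiE {..<n} (\<lambda>_. UNIV))"
      using imageI[of "restrict x {..<n}" "PiE {..<n} (\<lambda>_. UNIV)" "cylinder n"] by simp
  qed
qed

lemma cylindrical_mono: "cylindrical m A \<Longrightarrow> m \<le> n \<Longrightarrow> cylindrical n A"
  unfolding cylindrical_def using cylinder_antimono by blast

lemma cylindrical_cylinder: "cylindrical n (cylinder n x)"
  by (simp add: cylindrical_def cylinder_def)

lemma cylindrical_hull: "cylindrical n (cylinder_hull n S)"
  by (fastforce simp: cylindrical_def cylinder_hull_def cylinder_def)

lemma cylindrical_empty: "cylindrical n {}"
  by (simp add: cylindrical_def)

lemma cylindrical_UNIV: "cylindrical n UNIV"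
  by (simp add: cylindrical_def)

lemma cylindrical_Un: "cylindrical n A \<Longrightarrow> cylindrical n B \<Longrightarrow> cylindrical n (A \<union> B)"
  by (auto simp: cylindrical_def)

lemma cylindrical_Int: "cylindrical n A \<Longrightarrow> cylindrical n B \<Longrightarrow> cylindrical n (A \<inter> B)"
  by (auto simp: cylindrical_def)

lemma cylindrical_Compl: "cylindrical n A \<Longrightarrow> cylindrical n (- A)"
  unfolding cylindrical_def
proof (intro ballI subsetI ComplI)
  fix x w assume "\<forall>x\<in>A. cylinder n x \<subseteq> A" "x \<in> - A" "w \<in> cylinder n x" "w \<in> A"
  moreover have "x \<in> cylinder n w" using \<open>w \<in> cylinder n x\<close> by (simp only: mem_cylinder_sym)
  ultimately show False by blast
qed

lemma cylindrical_sets_I: "cylindrical n A \<Longrightarrow> A \<in> cylindrical_sets"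
  by (auto simp: cylindrical_sets_def)

lemma cylindrical_sets_pair:
  assumes "A \<in> cylindrical_sets" "B \<in> cylindrical_sets"
  obtains n where "cylindrical n A" "cylindrical n B"
proof -
  obtain i j where "cylindrical i A" "cylindrical j B"
    using assms by (auto simp: cylindrical_sets_def)
  then have "cylindrical (max i j) A" "cylindrical (max i j) B"
    using cylindrical_mono max.cobounded1 max.cobounded2 by blast+
  then show thesis by (rule that)
qed

lemma algebra_cylindrical_sets: "algebra UNIV (cylindrical_sets :: 'a past set set)"
proof (rule algebra_iff_Un[THEN iffD2], intro conjI ballI)
  fix A B :: "'a past set" assume "A \<in> cylindrical_sets" "B \<in> cylindrical_sets"
  then obtain n where "cylindrical n A" "cylindrical n B" by (rule cylindrical_sets_pair)
  then show "A \<union> B \<in> cylindrical_sets" by (intro cylindrical_sets_I[of n] cylindrical_Un)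
next
  fix A :: "'a past set" assume "A \<in> cylindrical_sets"
  then obtain n where "cylindrical n A" by (auto simp: cylindrical_sets_def)
  then show "UNIV - A \<in> cylindrical_sets"
    unfolding Compl_eq_Diff_UNIV[symmetric] by (intro cylindrical_sets_I[of n] cylindrical_Compl)
qed (use cylindrical_sets_I[OF cylindrical_empty] in auto)

lemma Int_stable_cylindrical_sets: "Int_stable (cylindrical_sets :: 'a past set set)"
  proof (rule Int_stableI)
  fix A B :: "'a past set" assume "A \<in> cylindrical_sets" "B \<in> cylindrical_sets"
  then obtain n where "cylindrical n A" "cylindrical n B" by (rule cylindrical_sets_pair)
  then show "A \<inter> B \<in> cylindrical_sets" by (intro cylindrical_sets_I[of n] cylindrical_Int)
qed

lemma cylindrical_eq_Union:
  assumes "cylindrical n A"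
  shows "A = \<Union>{B \<in> cylinders n. B \<subseteq> A}"
proof
  show "A \<subseteq> \<Union>{B \<in> cylinders n. B \<subseteq> A}"
  proof
    fix x assume "x \<in> A"
    then have "cylinder n x \<in> {B \<in> cylinders n. B \<subseteq> A}"
      using assms by (simp add: cylindrical_def cylinders_def)
    then show "x \<in> \<Union>{B \<in> cylinders n. B \<subseteq> A}" using mem_cylinder_self by blast
  qed
qed blast

text \<open>Each level contributes only the unions of finitely many cylinders. Countability is what
  permits the diagonal extraction in \<open>cesaro_limit_measure\<close>.\<close>

lemma countable_cylindrical_sets: "countable (cylindrical_sets :: 'a::finite past set set)"
proof -
  have "cylindrical_sets \<subseteq> (\<Union>n. Union ` Pow (cylinders n :: 'a past set set))"
    proof
    fix A :: "'a past set" assume "A \<in> cylindrical_sets"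
    then obtain n where "cylindrical n A" by (auto simp: cylindrical_sets_def)
    then have "A = \<Union>{B \<in> cylinders n. B \<subseteq> A}" by (rule cylindrical_eq_Union)
    then have "A \<in> Union ` Pow (cylinders n)" by (rule image_eqI) blast
    then show "A \<in> (\<Union>n. Union ` Pow (cylinders n))" by blast
  qed
  then show ?thesis
    by (rule countable_subset) (simp add: countable_finite finite_cylinders)
qed

section \<open>The product sigma-algebra in terms of cylinders\<close>

lemma space_past_algebra [simp]: "space past_algebra = UNIV"
  by (simp add: past_algebra_def space_PiM)

text \<open>Events on a single coordinate generate the product sigma-algebra and are cylindrical.
  Conversely a cylindrical set is a finite union of cylinders, each given by finitely many
  coordinate conditions.\<close>

lemma sets_past_algebra: "sets (past_algebra :: 'a::finite past measure) = sigma_sets UNIV cylindrical_sets"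
proof
  have "{f. f i \<in> A} \<in> cylindrical_sets" for i and A :: "'a set"
    by (rule cylindrical_sets_I[of "Suc i"]) (auto simp: cylindrical_def cylinder_def)
  then show "sets (past_algebra :: 'a past measure) \<subseteq> sigma_sets UNIV cylindrical_sets"
    unfolding past_algebra_def sets_PiM_single by (auto simp: PiE_UNIV_domain intro!: sigma_sets_mono')
  have cyl: "cylinder n x \<in> sets past_algebra" for n and x :: "'a past"
  proof -
    have "cylinder n x = {w \<in> space past_algebra. \<forall>i\<in>{..<n}. w i = x i}"
      by (auto simp: cylinder_def)
    also have "\<dots> \<in> sets past_algebra"
      unfolding past_algebra_def by measurable
    finally show ?thesis .
  qed
  have "A \<in> sets past_algebra" if A: "A \<in> cylindrical_sets" for A :: "'a past set"
  proof -
    obtain n where "A = \<Union>{B \<in> cylinders n. B \<subseteq> A}"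
      using cylindrical_eq_Union A unfolding cylindrical_sets_def by blast
    moreover have "\<Union>{B \<in> cylinders n. B \<subseteq> A} \<in> sets past_algebra"
    proof (rule sets.finite_Union)
      show "finite {B \<in> cylinders n. B \<subseteq> A}" by (simp add: finite_cylinders)
    qed (auto simp: cylinders_def cyl)
    ultimately show ?thesis by simp
  qed
  then show "sigma_sets UNIV cylindrical_sets \<subseteq> sets (past_algebra :: 'a past measure)"
    by (metis sets.sigma_sets_subset space_past_algebra subsetI)
qed

lemma cylindrical_in_sets: "cylindrical n A \<Longrightarrow> (A :: 'a::finite past set) \<in> sets past_algebra"
  by (simp add: sets_past_algebra cylindrical_sets_I sigma_sets.Basic)

section \<open>The product topology: cylinder neighbourhoods and compactness\<close>

lemma topspace_past_topology [simp]: "topspace past_topology = UNIV"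
  by (simp add: past_topology_def PiE_UNIV_domain)

lemma openin_cylinder: "openin past_topology (cylinder n x)"
proof -
  have "cylinder n x = PiE UNIV (\<lambda>i. if i < n then {x i} else UNIV)"
    by (auto simp: cylinder_def PiE_UNIV_domain Pi_iff split: if_split_asm)
  moreover have "openin past_topology (PiE UNIV (\<lambda>i. if i < n then {x i} else UNIV))"
    unfolding past_topology_def
    by (rule product_topology_basis) (auto intro: finite_subset[of _ "{..<n}"])
  ultimately show ?thesis by simp
qed

lemma openin_past_topology:
  "openin past_topology S \<longleftrightarrow> (\<forall>x\<in>S. \<exists>n. cylinder n x \<subseteq> S)"
proof (intro iffI ballI)
  fix x assume "openin past_topology S" "x \<in> S"
  then obtain U where fin: "finite {i. U i \<noteq> UNIV}" and x: "x \<in> Pi\<^sub>E UNIV U"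
    and S: "Pi\<^sub>E UNIV U \<subseteq> S"
    unfolding past_topology_def openin_product_topology_alt by auto
  obtain n where "{i. U i \<noteq> UNIV} \<subseteq> {..<n}" using finite_nat_iff_bounded fin by blast
  then have "cylinder n x \<subseteq> Pi\<^sub>E UNIV U"
    using x by (auto simp: cylinder_def PiE_UNIV_domain Pi_iff) (metis (mono_tags) UNIV_I lessThan_iff mem_Collect_eq subset_iff)
  then show "\<exists>n. cylinder n x \<subseteq> S" using S by blast
next
  assume r: "\<forall>x\<in>S. \<exists>n. cylinder n x \<subseteq> S"
  show "openin past_topology S"
  proof (subst openin_subopen, intro ballI)
    fix x assume "x \<in> S"
    then obtain n where "cylinder n x \<subseteq> S" using r by blast
    then show "\<exists>T. openin past_topology T \<and> x \<in> T \<and> T \<subseteq> S"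
      using openin_cylinder mem_cylinder_self by (intro exI[of _ "cylinder n x"]) simp
  qed
qed

lemma closedin_cylindrical:
  assumes "cylindrical n A" shows "closedin past_topology A"
proof -
  have "openin past_topology (- A)"
    using cylindrical_Compl[OF assms] unfolding openin_past_topology cylindrical_def by blast
  then show ?thesis by (simp add: closedin_def Compl_eq_Diff_UNIV)
qed

lemma compact_past_topology: "compact_space (past_topology :: 'a::finite past topology)"
  unfolding past_topology_def
  by (simp add: compact_space_product_topology compact_space_discrete_topology)

text \<open>Cylindrical sets are closed in a compact space, so nested nonempty ones have a common
  point. This serves twice: for continuity at the empty set in the Caratheodory extension, and for
  uniform continuity of \<open>transfer g (indicator A)\<close> off a clopen set.\<close>

lemma decseq_cylindrical_empty:
  fixes A :: "nat \<Rightarrow> 'a::finite past set"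
  assumes "\<And>n. A n \<in> cylindrical_sets" "decseq A" "(\<Inter>n. A n) = {}"
  obtains n where "A n = {}"
proof -
  have "closedin past_topology (A n)" for n
    using assms(1) closedin_cylindrical by (auto simp: cylindrical_sets_def)
  then show thesis
    using compact_space_imp_nest[OF compact_past_topology, of A] assms(2,3) that by blast
qed

section \<open>Continuity points and measurability of the discontinuity set\<close>

lemma notin_discontinuities_iff:
  "x \<notin> discontinuities g \<longleftrightarrow> (\<forall>e>0. \<exists>n. \<forall>w\<in>cylinder n x. \<bar>g w - g x\<bar> < e)"
proof
  assume x: "x \<notin> discontinuities g"
  show "\<forall>e>0. \<exists>n. \<forall>w\<in>cylinder n x. \<bar>g w - g x\<bar> < e"
  proof (intro allI impI)
    fix e :: real assume "e > 0"
    then have "openin euclideanreal (ball (g x) e)" "g x \<in> ball (g x) e" by auto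
    then obtain U where U: "openin past_topology U" "x \<in> U" "\<forall>y\<in>U. g y \<in> ball (g x) e"
      using x unfolding discontinuities_def topcontinuous_at_def by blast
    then obtain n where "cylinder n x \<subseteq> U" unfolding openin_past_topology by blast
    then show "\<exists>n. \<forall>w\<in>cylinder n x. \<bar>g w - g x\<bar> < e"
      using U(3) by (intro exI[of _ n]) (auto simp: dist_real_def abs_minus_commute)
  qed
next
  assume r: "\<forall>e>0. \<exists>n. \<forall>w\<in>cylinder n x. \<bar>g w - g x\<bar> < e"
  have "\<exists>U. openin past_topology U \<and> x \<in> U \<and> (\<forall>y\<in>U. g y \<in> V)" if "open V" "g x \<in> V" for V
  proof -
    obtain e where "e > 0" "ball (g x) e \<subseteq> V" using openE \<open>open V\<close> \<open>g x \<in> V\<close> by blast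
    moreover obtain n where "\<forall>w\<in>cylinder n x. \<bar>g w - g x\<bar> < e" using r \<open>e > 0\<close> by blast
    ultimately have "\<forall>y\<in>cylinder n x. g y \<in> V"
      by (auto simp: dist_real_def abs_minus_commute subset_iff)
    then show ?thesis using openin_cylinder mem_cylinder_self by blast
  qed
  then show "x \<notin> discontinuities g"
    unfolding discontinuities_def topcontinuous_at_def by auto
qed

text \<open>The continuity points are those at which the oscillation of \<open>g\<close> over
  cylinders becomes arbitrarily small. The condition defining \<open>G j n\<close> depends on the
  cylinder alone, so \<open>G j n\<close> is cylindrical and the continuity points form a countable
  intersection of open sets.\<close>

lemma discontinuities_sets: "discontinuities g \<in> sets (past_algebra :: 'a::finite past measure)"
proof -
  define G where "G j n = {x. \<forall>w\<in>cylinder n x. \<forall>z\<in>cylinder n x. \<bar>g w - g z\<bar> < 1 / real (Suc j)}"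
    for j n
  have G: "cylindrical n (G j n)" for j n
    unfolding cylindrical_def
  proof (intro ballI subsetI)
    fix x w assume "x \<in> G j n" and w: "w \<in> cylinder n x"
    then show "w \<in> G j n" unfolding G_def mem_Collect_eq cylinder_eq[OF w] by simp
  qed
  have "- discontinuities g = (\<Inter>j. \<Union>n. G j n)"
  proof (intro equalityI subsetI)
    fix x assume "x \<in> - discontinuities g"
    then have *: "\<forall>e>0. \<exists>n. \<forall>w\<in>cylinder n x. \<bar>g w - g x\<bar> < e"
      by (simp add: notin_discontinuities_iff)
    have "\<exists>n. x \<in> G j n" for j
    proof -
      obtain n where n: "\<And>w. w \<in> cylinder n x \<Longrightarrow> \<bar>g w - g x\<bar> < 1 / real (Suc j) / 2"
        using *[rule_format, of "1 / real (Suc j) / 2"] by auto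
      have "x \<in> G j n"
        unfolding G_def
      proof (intro CollectI ballI)
        fix w z assume "w \<in> cylinder n x" "z \<in> cylinder n x"
        then have "\<bar>g w - g x\<bar> < 1 / real (Suc j) / 2" "\<bar>g z - g x\<bar> < 1 / real (Suc j) / 2"
          using n by blast+
        then show "\<bar>g w - g z\<bar> < 1 / real (Suc j)" 
            using field_sum_of_halves[of "1 / real (Suc j)"] unfolding abs_less_iff by linarith
      qed
      then show ?thesis ..
    qed
    then show "x \<in> (\<Inter>j. \<Union>n. G j n)" by blast
  next
    fix x assume x: "x \<in> (\<Inter>j. \<Union>n. G j n)"
    have "\<exists>n. \<forall>w\<in>cylinder n x. \<bar>g w - g x\<bar> < e" if "e > 0" for e
    proof -
      obtain j where j: "1 / real (Suc j) < e" using \<open>e > 0\<close> by (metis nat_approx_posE)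
      obtain n where "x \<in> G j n" using x by blast
      then have "\<forall>w\<in>cylinder n x. \<bar>g w - g x\<bar> < 1 / real (Suc j)"
        unfolding G_def by simp
      then show ?thesis using j by (meson less_trans)
    qed
    then show "x \<in> - discontinuities g" by (simp add: notin_discontinuities_iff)
  qed
  moreover have "(\<Union>n. G j n) \<in> sets past_algebra" for j
    using cylindrical_in_sets[OF G] by (intro sets.countable_UN) blast
  then have "(\<Inter>j. \<Union>n. G j n) \<in> sets past_algebra"
    by (intro sets.countable_INT) auto
  ultimately have "- discontinuities g \<in> sets past_algebra"
    by (simp only:)
  then have "space past_algebra - - discontinuities g \<in> sets past_algebra"
    by (rule sets.compl_sets)
  then show ?thesis
    by (simp only: space_past_algebra Compl_eq_Diff_UNIV[symmetric] double_complement)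
qed

subsection \<open>The transfer operator\<close>

definition transfer :: "('a::finite past \<Rightarrow> real) \<Rightarrow> ('a past \<Rightarrow> real) \<Rightarrow> 'a past \<Rightarrow> real" where
  "transfer g f x = (\<Sum>a\<in>UNIV. g (append_symbol x a) * f (append_symbol x a))"

text \<open>At \<open>n = 0\<close> division by zero gives the value \<open>0\<close>, so the
  normalisation \<open>cesaro_const\<close> asks for a positive \<open>n\<close>.\<close>

definition cesaro :: "('a::finite past \<Rightarrow> real) \<Rightarrow> 'a past \<Rightarrow> nat \<Rightarrow> ('a past \<Rightarrow> real) \<Rightarrow> real" where
  "cesaro g x n f = (\<Sum>k<n. (transfer g ^^ k) f x) / real n"

lemma g_function_nonneg: "g_function g \<Longrightarrow> 0 \<le> g x"
  and g_function_le_1: "g_function g \<Longrightarrow> g x \<le> 1"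
  and g_function_sum: "g_function g \<Longrightarrow> (\<Sum>a\<in>UNIV. g (append_symbol x a)) = 1"
  by (auto simp: g_function_def)

lemma transfer_mono:
  assumes "g_function g" "\<And>x. f x \<le> h x"
  shows "transfer g f x \<le> transfer g h x"
  unfolding transfer_def
  by (intro sum_mono mult_left_mono assms g_function_nonneg)

lemma transfer_const: "g_function g \<Longrightarrow> transfer g (\<lambda>_. c) = (\<lambda>_. c)"
  by (simp add: transfer_def fun_eq_iff sum_distrib_right[symmetric] g_function_sum)

text \<open>Linearity is put in the form of a finite combination because this form passes directly
  to iterates and to Cesaro means.\<close>

lemma transfer_sum:
  "transfer g (\<lambda>x. \<Sum>i\<in>I. c i * f i x) = (\<lambda>x. \<Sum>i\<in>I. c i * transfer g (f i) x)"
  unfolding transfer_def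
  by (subst sum_distrib_left, subst sum_distrib_left, subst sum.swap) (simp add: mult_ac)

lemma funpow_transfer_mono:
  assumes "g_function g" "\<And>x. f x \<le> h x"
  shows "(transfer g ^^ k) f x \<le> (transfer g ^^ k) h x"
proof (induction k arbitrary: x)
  case (Suc k)
  then show ?case by (simp add: transfer_mono assms(1))
qed (simp add: assms)

lemma funpow_transfer_const: "g_function g \<Longrightarrow> (transfer g ^^ k) (\<lambda>_. c) = (\<lambda>_. c)"
  by (induction k) (simp_all add: transfer_const)

lemma funpow_transfer_sum:
  "(transfer g ^^ k) (\<lambda>x. \<Sum>i\<in>I. c i * f i x) = (\<lambda>x. \<Sum>i\<in>I. c i * (transfer g ^^ k) (f i) x)"
  by (induction k) (simp_all add: transfer_sum)

text \<open>The iterates are monotone and fix the constants \<open>c\<close> and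
  \<open>d\<close>.\<close>

lemma funpow_transfer_bounds:
  assumes "g_function g" "\<And>x. c \<le> f x" "\<And>x. f x \<le> d"
  shows "c \<le> (transfer g ^^ k) f x" "(transfer g ^^ k) f x \<le> d"
  using funpow_transfer_mono[OF assms(1), of "\<lambda>_. c" f k x]
    funpow_transfer_mono[OF assms(1), of f "\<lambda>_. d" k x]
  by (simp_all add: assms funpow_transfer_const)

section \<open>Cesaro means of the iterates\<close>

lemma cesaro_mono:
  assumes "g_function g" "\<And>x. f x \<le> h x"
  shows "cesaro g x n f \<le> cesaro g x n h"
  unfolding cesaro_def by (intro divide_right_mono sum_mono funpow_transfer_mono assms) simp_all

lemma cesaro_const: "g_function g \<Longrightarrow> 0 < n \<Longrightarrow> cesaro g x n (\<lambda>_. c) = c"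
  by (simp add: cesaro_def funpow_transfer_const)

lemma cesaro_sum: "cesaro g x n (\<lambda>x. \<Sum>i\<in>I. c i * f i x) = (\<Sum>i\<in>I. c i * cesaro g x n (f i))"
  unfolding cesaro_def funpow_transfer_sum
  by (subst sum.swap) (simp add: sum_distrib_left sum_divide_distrib)

lemma cesaro_add: "cesaro g x n (\<lambda>x. f x + h x) = cesaro g x n f + cesaro g x n h"
  \<comment> \<open>A binary sum is a combination indexed by \<open>bool\<close> with both
    coefficients \<open>1\<close>.\<close>
  using cesaro_sum[of g x n "\<lambda>_. 1" "case_bool f h" "UNIV :: bool set"]
  by (simp add: UNIV_bool add.commute)

lemma cesaro_cmult: "cesaro g x n (\<lambda>x. c * f x) = c * cesaro g x n f"
  using cesaro_sum[of g x n "\<lambda>_. c" "\<lambda>_. f" "{()}"] by simp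

lemma cesaro_bounds:
  assumes "g_function g" "\<And>x. 0 \<le> f x" "\<And>x. f x \<le> 1"
  shows "0 \<le> cesaro g x n f" "cesaro g x n f \<le> 1"
proof -
  show "0 \<le> cesaro g x n f"
    unfolding cesaro_def using funpow_transfer_bounds(1)[OF assms]
    by (intro divide_nonneg_nonneg sum_nonneg) auto
  show "cesaro g x n f \<le> 1"
  proof (cases "n = 0")
    case False
    then show ?thesis
      using cesaro_mono[OF assms(1), of f "\<lambda>_. 1" x n] assms cesaro_const[OF assms(1), of n x 1] by simp
  qed (simp add: cesaro_def)
qed

text \<open>The two sums telescope: applying the operator once more trades \<open>f x\<close> for
  the \<open>n\<close>-th iterate at \<open>x\<close>. Both values lie in [0,1], so the difference
  is at most \<open>1 / n\<close>.\<close>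

lemma cesaro_transfer:
  assumes "g_function g" "\<And>x. 0 \<le> f x" "\<And>x. f x \<le> 1"
  shows "(\<lambda>n. cesaro g x n (transfer g f) - cesaro g x n f) \<longlonglongrightarrow> 0"
proof (rule tendsto_0_le[OF lim_inverse_n', where K=1])
  show "\<forall>\<^sub>F n in sequentially.
    norm (cesaro g x n (transfer g f) - cesaro g x n f) \<le> norm (1 / real n) * 1"
  proof (intro always_eventually allI)
    fix n
    have "cesaro g x n (transfer g f) - cesaro g x n f
        = (\<Sum>k<n. (transfer g ^^ Suc k) f x - (transfer g ^^ k) f x) / real n"
      by (simp add: cesaro_def funpow_swap1 sum_subtractf diff_divide_distrib)
    also have "\<dots> = ((transfer g ^^ n) f x - f x) / real n"
      by (subst sum_lessThan_telescope) simp
    also have "norm \<dots> \<le> 1 / real n"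
      using funpow_transfer_bounds[where f=f and c=0 and d=1 and k=n and x=x, OF assms] assms(2,3)[of x]
      by (simp add: divide_right_mono abs_le_iff)
    finally show "norm (cesaro g x n (transfer g f) - cesaro g x n f) \<le> norm (1 / real n) * 1"
      by simp
  qed
qed

lemma cesaro_funpow_transfer:
  assumes "g_function g" "\<And>x. 0 \<le> f x" "\<And>x. f x \<le> 1"
  shows "(\<lambda>n. cesaro g x n ((transfer g ^^ k) f) - cesaro g x n f) \<longlonglongrightarrow> 0"
proof (induction k)
  case (Suc k)
  have "(\<lambda>n. cesaro g x n (transfer g ((transfer g ^^ k) f)) - cesaro g x n ((transfer g ^^ k) f)) \<longlonglongrightarrow> 0"
    by (intro cesaro_transfer assms(1) funpow_transfer_bounds[where c=0 and d=1 and f=f] assms)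
  from tendsto_add[OF this Suc] show ?case by simp
qed simp

subsection \<open>Mass of the cylinders meeting the discontinuity set\<close>

text \<open>These are the sequences obtained from \<open>y\<close> by appending a word of length
  \<open>n\<close>; they index the terms of the \<open>n\<close>-th iterate of
  \<open>transfer g\<close> at \<open>y\<close>.\<close>

definition preimages :: "nat \<Rightarrow> 'a past \<Rightarrow> 'a past set" where
  "preimages n y = {z. (shift ^^ n) z = y}"

lemma shift_funpow: "(shift ^^ n) z i = z (n + i)"
  by (induction n arbitrary: i) (simp_all add: shift_def)

lemma preimages_Suc: "preimages (Suc n) y = (\<Union>a. preimages n (append_symbol y a))"
proof -
  have "z \<in> (\<Union>a. preimages n (append_symbol y a))" if "z \<in> preimages (Suc n) y" for z
  proof -
    \<comment> \<open>The symbol appended first to \<open>y\<close> is the coordinate of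
      \<open>z\<close> at index \<open>n\<close>.\<close>
    have "append_symbol y ((shift ^^ n) z 0) = (shift ^^ n) z"
      using that append_shift[of "(shift ^^ n) z"] by (simp add: preimages_def)
    then show ?thesis by (auto simp: preimages_def) (metis)
  qed
  then show ?thesis by (auto simp: preimages_def)
qed

lemma finite_preimages: "finite (preimages n (y :: 'a::finite past))"
proof (induction n arbitrary: y)
  case 0
  have "preimages 0 y = {y}" by (auto simp: preimages_def)
  then show ?case by simp
qed (simp add: preimages_Suc)

text \<open>Induction on \<open>n\<close>, splitting the preimages of \<open>y\<close> by the symbol
  that is appended first to \<open>y\<close>.\<close>

lemma funpow_transfer_eq:
  "(transfer g ^^ n) f y = (\<Sum>z\<in>preimages n y. g_prod g n z * f z)"
proof (induction n arbitrary: y)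
  case 0
  have "preimages 0 y = {y}" by (auto simp: preimages_def)
  then show ?case by (simp add: g_prod_def)
next
  case (Suc n)
  have disj: "preimages n (append_symbol y a) \<inter> preimages n (append_symbol y b) = {}" if "a \<noteq> b" for a b
    using that by (auto simp: preimages_def) (metis append_symbol_0)
  have "(transfer g ^^ Suc n) f y
      = (\<Sum>a\<in>UNIV. g (append_symbol y a) * (\<Sum>z\<in>preimages n (append_symbol y a). g_prod g n z * f z))"
    by (simp add: transfer_def Suc)
  also have "\<dots> = (\<Sum>a\<in>UNIV. \<Sum>z\<in>preimages n (append_symbol y a). g_prod g (Suc n) z * f z)"
    \<comment> \<open>For these \<open>z\<close> the extra factor of
      \<open>g_prod g (Suc n) z\<close> is \<open>g ((shift ^^ n) z)\<close>, which equals
      \<open>g (append_symbol y a)\<close>.\<close>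
    by (intro sum.cong refl) (auto simp: sum_distrib_left g_prod_def preimages_def mult_ac intro!: sum.cong)
  also have "\<dots> = (\<Sum>z\<in>(\<Union>a. preimages n (append_symbol y a)). g_prod g (Suc n) z * f z)"
    using disj by (intro sum.UNION_disjoint[symmetric]) (auto simp: finite_preimages)
  finally show ?case by (simp add: preimages_Suc)
qed

text \<open>This is the sum under the logarithm in \<open>pressure\<close>.\<close>

definition cylinder_mass :: "('a::finite past \<Rightarrow> real) \<Rightarrow> 'a past set \<Rightarrow> nat \<Rightarrow> real" where
  "cylinder_mass g S n = (\<Sum>B\<in>{B \<in> cylinders n. B \<inter> S \<noteq> {}}. SUP x\<in>B. g_prod g n x)"

lemma g_prod_bounds:
  assumes "g_function g" shows "0 \<le> g_prod g n x" "g_prod g n x \<le> 1"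
  unfolding g_prod_def
  using g_function_nonneg[OF assms] g_function_le_1[OF assms]
  by (auto intro!: prod_nonneg prod_le_1)

lemma g_prod_le_SUP:
  assumes "g_function g" "x \<in> B" shows "g_prod g n x \<le> (SUP x\<in>B. g_prod g n x)"
  using assms(2) by (intro cSUP_upper bdd_aboveI2[where M=1] g_prod_bounds assms(1))

lemma SUP_g_prod_nonneg:
  assumes "g_function g" "B \<in> cylinders n" shows "0 \<le> (SUP x\<in>B. g_prod g n x)"
proof -
  obtain x where "B = cylinder n x" using assms(2) by (auto simp: cylinders_def)
  then have "x \<in> B" by simp
  then show ?thesis using g_prod_le_SUP[OF assms(1)] g_prod_bounds(1)[OF assms(1)] order_trans by blast
qed

lemma cylinder_mass_nonneg: "g_function g \<Longrightarrow> 0 \<le> cylinder_mass g S n"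
  unfolding cylinder_mass_def by (intro sum_nonneg SUP_g_prod_nonneg) auto

text \<open>Two points of \<open>preimages n y\<close> agree at every index from \<open>n\<close>
  on, so an \<open>n\<close>-cylinder contains at most one of them. The iterate at \<open>y\<close>
  therefore has at most one term for each cylinder meeting \<open>S\<close>, and that term is at
  most the supremum over the cylinder.\<close>

lemma funpow_transfer_hull_le:
  assumes g: "g_function g"
  shows "(transfer g ^^ n) (indicator (cylinder_hull n S)) y \<le> cylinder_mass g S n"
proof -
  let ?P = "preimages n y \<inter> cylinder_hull n S"
  let ?s = "\<lambda>B. SUP x\<in>B. g_prod g n x"
  have inj: "inj_on (cylinder n) ?P"
  proof (rule inj_onI)
    fix z w assume "z \<in> ?P" "w \<in> ?P" and eq: "cylinder n z = cylinder n w"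
    then have t: "(shift ^^ n) z = (shift ^^ n) w" by (simp add: preimages_def)
    have c: "z \<in> cylinder n w" using eq mem_cylinder_self by metis
    show "z = w"
    proof
      fix i
      show "z i = w i"
      proof (cases "i < n")
        case False
        then show ?thesis
          using fun_cong[OF t, of "i - n"] by (simp add: shift_funpow)
      qed (use c in \<open>simp add: cylinder_def\<close>)
    qed
  qed
  have "(transfer g ^^ n) (indicator (cylinder_hull n S)) y = (\<Sum>z\<in>?P. g_prod g n z)"
    unfolding funpow_transfer_eq
    by (auto simp: sum.inter_restrict[OF finite_preimages] intro!: sum.cong)
  also have "\<dots> \<le> (\<Sum>z\<in>?P. ?s (cylinder n z))"
    by (intro sum_mono g_prod_le_SUP g mem_cylinder_self)
  also have "\<dots> = (\<Sum>B\<in>cylinder n ` ?P. ?s B)"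
    by (simp add: sum.reindex[OF inj])
  also have "\<dots> \<le> cylinder_mass g S n"
    unfolding cylinder_mass_def
  proof (rule sum_mono2)
    show "finite {B \<in> cylinders n. B \<inter> S \<noteq> {}}" by (simp add: finite_cylinders)
    show "cylinder n ` ?P \<subseteq> {B \<in> cylinders n. B \<inter> S \<noteq> {}}"
    proof (rule image_subsetI)
      fix z assume "z \<in> ?P"
      then obtain x where "x \<in> S" "z \<in> cylinder n x" by (auto simp: cylinder_hull_def)
      then have "x \<in> cylinder n z \<inter> S" using mem_cylinder_sym[of x n z] by simp
      then show "cylinder n z \<in> {B \<in> cylinders n. B \<inter> S \<noteq> {}}" by (auto simp: cylinders_def)
    qed
  qed (use SUP_g_prod_nonneg[OF g] in auto)
  finally show ?thesis .
qed

text \<open>Choosing \<open>b\<close> strictly between the pressure and \<open>0\<close> gives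
  eventual geometric decay with ratio \<open>exp b\<close>.\<close>

lemma cylinder_mass_tendsto_0:
  assumes g: "g_function g" and p: "pressure g S < 0"
  shows "cylinder_mass g S \<longlonglongrightarrow> 0"
proof -
  obtain b where b: "pressure g S < ereal b" "ereal b < 0"
    using ereal_dense2[OF p] by auto
  have "\<forall>\<^sub>F n in sequentially. ereal (1 / real n) * ext_log (cylinder_mass g S n) < ereal b"
    using b(1) unfolding pressure_def cylinder_mass_def by (rule Limsup_lessD)
  then have le: "\<forall>\<^sub>F n in sequentially. cylinder_mass g S n \<le> exp b ^ n"
    using eventually_gt_at_top[of 0]
  proof eventually_elim
    case (elim n)
    show ?case
    \<comment> \<open>A vanishing mass meets the bound trivially; otherwise \<open>ext_log\<close>
      is the ordinary logarithm and can be inverted.\<close>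
    proof (cases "cylinder_mass g S n = 0")
      case False
      then have pos: "cylinder_mass g S n > 0" using cylinder_mass_nonneg[OF g, of S n] by simp
      have "ln (cylinder_mass g S n) / real n < b"
        using elim False by (simp add: ext_log_def)
      then have "ln (cylinder_mass g S n) < real n * b"
        using elim(2) by (simp add: divide_less_eq mult.commute)
      then have "cylinder_mass g S n < exp (real n * b)"
        using pos by (metis exp_less_mono exp_ln)
      then show ?thesis by (simp add: exp_of_nat_mult)
    qed simp
  qed
  have lim: "(\<lambda>n. exp b ^ n) \<longlonglongrightarrow> 0"
    using b(2) by (intro LIMSEQ_realpow_zero) auto
  have "\<forall>\<^sub>F n in sequentially. 0 \<le> cylinder_mass g S n"
    using cylinder_mass_nonneg[OF g] by simp
  from tendsto_sandwich[OF this le tendsto_const lim] show ?thesis .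
qed

subsection \<open>The limit measure\<close>

text \<open>Diagonal extraction yields a finitely additive limit on the cylindrical sets.
  Compactness makes it continuous at the empty set, so it extends by Caratheodory to the whole
  sigma-algebra.\<close>

lemma cesaro_limit_measure:
  fixes g :: "'a::finite past \<Rightarrow> real"
  assumes g: "g_function g"
  obtains \<mu> r where "prob_space \<mu>" "sets \<mu> = sets past_algebra" "strict_mono (r :: nat \<Rightarrow> nat)"
    "\<And>A. A \<in> cylindrical_sets \<Longrightarrow> (\<lambda>n. cesaro g x (r n) (indicator A)) \<longlonglongrightarrow> measure \<mu> A"
proof -
  let ?c = "\<lambda>n A. cesaro g x n (indicator A)"
  have bounds: "0 \<le> ?c n A" "?c n A \<le> 1" for n A
    using cesaro_bounds[OF g, of "indicator A" x n] by auto
  have "norm (?c n A) \<le> 1" for n A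
    using bounds[of n A] by simp
  \<comment> \<open>The diagonal argument is applied to functions whose points are the cylindrical
    sets, with the uniform bound \<open>1\<close>.\<close>
  then obtain r where r: "strict_mono r"
    and conv: "\<And>A. A \<in> cylindrical_sets \<Longrightarrow> \<exists>l. (\<lambda>n. ?c (r n) A) \<longlonglongrightarrow> l"
    using function_convergent_subsequence[OF countable_cylindrical_sets, of ?c 1] by blast
  define m where "m A = lim (\<lambda>n. ?c (r n) A)" for A
  have m: "(\<lambda>n. ?c (r n) A) \<longlonglongrightarrow> m A" if "A \<in> cylindrical_sets" for A
    using conv[OF that] unfolding m_def by (simp add: convergent_LIMSEQ_iff[symmetric] convergent_def)
  have m_nonneg: "0 \<le> m A" if "A \<in> cylindrical_sets" for A
    using m[OF that] bounds(1) by (intro LIMSEQ_le_const) auto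
  have m_empty: "m {} = 0"
    by (simp add: m_def indicator_def[abs_def] cesaro_def funpow_transfer_const[OF g])
  interpret algebra UNIV "cylindrical_sets :: 'a past set set" by (rule algebra_cylindrical_sets)
  have m_UNIV: "m UNIV = 1"
  proof (rule LIMSEQ_unique[OF m])
    show "(\<lambda>n. ?c (r n) UNIV) \<longlonglongrightarrow> 1"
    proof (rule tendsto_eventually)
      have "?c (r n) UNIV = 1" if "n > 0" for n
        using cesaro_const[OF g, of "r n" x 1] seq_suble[OF r, of n] that
        by (simp add: indicator_def[abs_def])
      then show "\<forall>\<^sub>F n in sequentially. ?c (r n) UNIV = 1"
        using eventually_gt_at_top[of 0] by (rule eventually_mono[rotated])
    qed
  qed auto
  have m_add: "m (A \<union> B) = m A + m B"
    if "A \<in> cylindrical_sets" "B \<in> cylindrical_sets" "A \<inter> B = {}" for A B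
  proof (rule LIMSEQ_unique[OF m])
    have "indicator (A \<union> B) = (\<lambda>x. indicator A x + indicator B x :: real)"
      by (rule ext) (rule indicator_disj_union[OF that(3)])
    then have "?c n (A \<union> B) = ?c n A + ?c n B" for n
      by (simp only: cesaro_add)
    then show "(\<lambda>n. ?c (r n) (A \<union> B)) \<longlonglongrightarrow> m A + m B"
      using tendsto_add[OF m m] that by simp
  qed (use that in auto)
  have "\<exists>\<nu> :: 'a past set \<Rightarrow> ennreal. (\<forall>s\<in>cylindrical_sets. \<nu> s = ennreal (m s)) \<and>
      measure_space UNIV (sigma_sets UNIV cylindrical_sets) \<nu>"
  proof (rule caratheodory_empty_continuous)
    show "positive cylindrical_sets (\<lambda>A. ennreal (m A))"
      by (simp add: positive_def m_empty)
    show "additive cylindrical_sets (\<lambda>A. ennreal (m A))"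
      by (simp add: additive_def m_add m_nonneg ennreal_plus)
  next
    fix A :: "nat \<Rightarrow> 'a past set"
    assume A: "range A \<subseteq> cylindrical_sets" "decseq A" "(\<Inter>i. A i) = {}"
    \<comment> \<open>The sequence reaches the empty set at a finite stage, so its masses are
      eventually zero.\<close>
    then obtain k where k: "A k = {}"
      using decseq_cylindrical_empty[of A] by (metis range_subsetD)
    have "A n = {}" if "k \<le> n" for n
      using decseqD[OF A(2) that] k by simp
    then have "\<forall>\<^sub>F n in sequentially. ennreal (m (A n)) = 0"
      unfolding eventually_sequentially using m_empty by (intro exI[of _ k]) simp
    then show "(\<lambda>n. ennreal (m (A n))) \<longlonglongrightarrow> 0"
      by (rule tendsto_eventually)
  qed simp
  then obtain \<nu> :: "'a past set \<Rightarrow> ennreal" where \<nu>: "\<And>A. A \<in> cylindrical_sets \<Longrightarrow> \<nu> A = ennreal (m A)"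
    and ms: "measure_space UNIV (sigma_sets UNIV cylindrical_sets) \<nu>"
    by blast
  define \<mu> where "\<mu> = measure_of UNIV (sets past_algebra) \<nu>"
  have sets: "sets \<mu> = sets past_algebra"
    unfolding \<mu>_def using sets.sigma_sets_eq[of "past_algebra :: 'a past measure"]
    by (simp add: sets_measure_of sets.space_closed[of past_algebra, simplified])
  have em: "emeasure \<mu> A = \<nu> A" if "A \<in> sets past_algebra" for A
    unfolding \<mu>_def
    by (rule emeasure_measure_of_sigma)
      (use ms that in \<open>auto simp: measure_space_def sets_past_algebra\<close>)
  have em_cyl: "emeasure \<mu> A = ennreal (m A)" if "A \<in> cylindrical_sets" for A
    using em \<nu> that by (simp add: sets_past_algebra)
  have "prob_space \<mu>"
  proof
    have "space \<mu> = UNIV" using sets_eq_imp_space_eq[OF sets] by simp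
    then show "emeasure \<mu> (space \<mu>) = 1" using em_cyl[OF top] m_UNIV by simp
  qed
  moreover have "measure \<mu> A = m A" if "A \<in> cylindrical_sets" for A
    using em_cyl[OF that] m_nonneg[OF that] by (simp add: measure_def)
  ultimately show thesis using sets r m by (intro that[of \<mu> r]) simp_all
qed

subsection \<open>Fixed points of the dual operator are g-measures\<close>

lemma append_symbol_measurable [measurable]:
  "(\<lambda>x. append_symbol x a) \<in> measurable past_algebra (past_algebra :: 'a::finite past measure)"
  unfolding past_algebra_def
proof (rule measurable_PiM_single')
  fix i :: nat
  show "(\<lambda>x. append_symbol x a i) \<in> measurable (Pi\<^sub>M UNIV (\<lambda>i. count_space UNIV)) (count_space UNIV)"
    by (cases i) (simp_all add: append_symbol_def)
qed (simp add: PiE_UNIV_domain)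

lemma shift_measurable [measurable]:
  "shift \<in> measurable past_algebra (past_algebra :: 'a::finite past measure)"
  unfolding past_algebra_def shift_def
  by (rule measurable_PiM_single') (simp_all add: PiE_UNIV_domain)

lemma g_function_measurable: "g_function g \<Longrightarrow> g \<in> borel_measurable past_algebra"
  by (simp add: g_function_def)

text \<open>Both sides are finite measures in \<open>A\<close> that agree on the intersection-stable
  generator \<open>cylindrical_sets\<close>, so induction over Dynkin systems carries the equality
  to all measurable sets.\<close>

lemma dual_fixed_point_sets:
  fixes g :: "'a::finite past \<Rightarrow> real"
  assumes g: "g_function g" and "prob_space \<mu>" and sets: "sets \<mu> = sets past_algebra"
    and fixed: "\<And>A. A \<in> cylindrical_sets \<Longrightarrow> (\<integral>x. transfer g (indicator A) x \<partial>\<mu>) = measure \<mu> A"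
    and A: "A \<in> sets past_algebra"
  shows "(\<Sum>a\<in>UNIV. \<integral>x. g (append_symbol x a) * indicator A (append_symbol x a) \<partial>\<mu>) = measure \<mu> A"
proof -
  interpret prob_space \<mu> by fact
  note [measurable_cong] = sets
  note [measurable] = g_function_measurable[OF g]
  have space [simp]: "space \<mu> = UNIV" using sets_eq_imp_space_eq[OF sets] by simp
  define q where "q a A = (\<integral>x. g (append_symbol x a) * indicator A (append_symbol x a) \<partial>\<mu>)" for a A
  \<comment> \<open>The sum of the \<open>\<nu> a\<close> is the image of \<mu> under the dual of
    \<open>transfer g\<close>. Writing the integral \<open>q a A\<close> as the mass of a measure
    supplies its countable additivity.\<close>
  define \<nu> where "\<nu> a = distr (density \<mu> (\<lambda>x. ennreal (g (append_symbol x a)))) past_algebra (\<lambda>x. append_symbol x a)" for a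
  have int: "integrable \<mu> (\<lambda>x. g (append_symbol x a) * indicator A (append_symbol x a))"
    if [measurable]: "A \<in> sets past_algebra" for A a
    by (rule integrable_const_bound[where B=1])
      (auto simp: indicator_def abs_le_iff g_function_le_1[OF g] order_trans[OF _ g_function_nonneg[OF g]])
  have em: "emeasure (\<nu> a) A = ennreal (q a A)" if [measurable]: "A \<in> sets past_algebra" for a A
  proof -
    have "emeasure (\<nu> a) A = (\<integral>\<^sup>+x. ennreal (g (append_symbol x a)) * indicator A (append_symbol x a) \<partial>\<mu>)"
    proof -
      have "emeasure (\<nu> a) A = (\<integral>\<^sup>+x. indicator A x \<partial>\<nu> a)"
        by (simp add: \<nu>_def)
      also have "\<dots> = (\<integral>\<^sup>+x. indicator A (append_symbol x a) \<partial>density \<mu> (\<lambda>x. ennreal (g (append_symbol x a))))"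
        unfolding \<nu>_def by (rule nn_integral_distr) measurable
      also have "\<dots> = (\<integral>\<^sup>+x. ennreal (g (append_symbol x a)) * indicator A (append_symbol x a) \<partial>\<mu>)"
        by (rule nn_integral_density) measurable
      finally show ?thesis .
    qed
    also have "\<dots> = (\<integral>\<^sup>+x. ennreal (g (append_symbol x a) * indicator A (append_symbol x a)) \<partial>\<mu>)"
      by (intro nn_integral_cong) (auto simp: indicator_def)
    also have "\<dots> = ennreal (q a A)"
      unfolding q_def by (intro nn_integral_eq_integral int that) (simp add: g_function_nonneg[OF g])
    finally show ?thesis .
  qed
  have q_nonneg: "0 \<le> q a A" for a A
    unfolding q_def by (intro Bochner_Integration.integral_nonneg) (simp add: g_function_nonneg[OF g])
  have me: "measure (\<nu> a) A = q a A" if "A \<in> sets past_algebra" for a A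
    using em[OF that] q_nonneg by (simp add: measure_def)
  have sets_\<nu>: "sets (\<nu> a) = sets past_algebra" "space (\<nu> a) = UNIV" for a
    by (simp_all add: \<nu>_def)
  have fin: "finite_measure (\<nu> a)" for a
    by standard (simp add: sets_\<nu> em[OF cylindrical_in_sets[OF cylindrical_UNIV]])
  have cyl: "(\<Sum>a\<in>UNIV. q a A) = measure \<mu> A" if "A \<in> cylindrical_sets" for A
  proof -
    have "A \<in> sets past_algebra" using that by (simp add: sets_past_algebra)
    then show ?thesis
      unfolding fixed[OF that, symmetric] transfer_def q_def
      by (intro Bochner_Integration.integral_sum[symmetric] int)
  qed
  have "cylindrical_sets \<subseteq> Pow (UNIV :: 'a past set)" by simp
  moreover have "A \<in> sigma_sets UNIV cylindrical_sets" using A by (simp add: sets_past_algebra)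
  ultimately have "(\<Sum>a\<in>UNIV. measure (\<nu> a) A) = measure \<mu> A"
  proof (induction rule: sigma_sets_induct_disjoint[OF Int_stable_cylindrical_sets, consumes 2, case_names basic empty compl union])
    case (basic A)
    then show ?case using cyl by (simp add: me sets_past_algebra)
  next
    case (compl A)
    then have A: "A \<in> sets past_algebra" by (simp add: sets_past_algebra)
    \<comment> \<open>Complements need equal total masses, which is the known equality for the
      cylindrical set \<open>UNIV\<close>.\<close>
    have "(\<Sum>a\<in>UNIV. measure (\<nu> a) UNIV) = 1"
      using cyl[OF cylindrical_sets_I[OF cylindrical_UNIV]] prob_space
      by (simp add: me[OF cylindrical_in_sets[OF cylindrical_UNIV]])
    moreover have "measure (\<nu> a) (UNIV - A) = measure (\<nu> a) UNIV - measure (\<nu> a) A" for a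
      using finite_measure.finite_measure_compl[OF fin, of A a] A by (simp add: sets_\<nu>)
    moreover have "measure \<mu> (UNIV - A) = 1 - measure \<mu> A"
      using prob_compl[of A] A sets by simp
    ultimately show ?case using compl by (simp add: sum_subtractf)
  next
    case (union B)
    then have B: "range B \<subseteq> sets past_algebra" by (simp add: sets_past_algebra)
    have "(\<lambda>i. \<Sum>a\<in>UNIV. measure (\<nu> a) (B i)) sums (\<Sum>a\<in>UNIV. measure (\<nu> a) (\<Union>i. B i))"
      using B union by (intro sums_sum finite_measure.finite_measure_UNION fin) (auto simp: sets_\<nu>)
    moreover have "(\<lambda>i. measure \<mu> (B i)) sums measure \<mu> (\<Union>i. B i)"
      using B union by (intro finite_measure_UNION) (auto simp: sets)
    ultimately show ?case using union by (simp add: sums_unique2)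
  qed auto
  then show ?thesis using me[OF A] by (simp add: q_def)
qed

text \<open>The fixed-point identity is tested on two kinds of sets. Preimages under
  \<open>shift\<close> give invariance because the weights sum to \<open>1\<close>; intersecting
  such a preimage with the event that the last symbol is \<open>a\<close> isolates one weight and
  gives the conditional expectation.\<close>

lemma g_measure_if_dual_fixed_point:
  fixes g :: "'a::finite past \<Rightarrow> real"
  assumes g: "g_function g" and "prob_space \<mu>" and sets: "sets \<mu> = sets past_algebra"
    and fixed: "\<And>A. A \<in> cylindrical_sets \<Longrightarrow> (\<integral>x. transfer g (indicator A) x \<partial>\<mu>) = measure \<mu> A"
  shows "g_measure g \<mu>"
proof -
  interpret prob_space \<mu> by fact
  note [measurable_cong] = sets
  note [measurable] = g_function_measurable[OF g]
  have space [simp]: "space \<mu> = UNIV" using sets_eq_imp_space_eq[OF sets] by simp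
  note fixed' = dual_fixed_point_sets[OF g \<open>prob_space \<mu>\<close> sets fixed]
  have bounded: "integrable \<mu> f" if "f \<in> borel_measurable past_algebra" "\<And>x. \<bar>f x\<bar> \<le> 1"
    for f :: "'a past \<Rightarrow> real"
    using that by (intro integrable_const_bound[where B=1]) auto
  have abs_g: "\<bar>g x\<bar> \<le> 1" for x
    using g_function_nonneg[OF g, of x] g_function_le_1[OF g, of x] by simp
  have int: "integrable \<mu> (\<lambda>x. g (append_symbol x a) * indicator A x)"
    if [measurable]: "A \<in> sets past_algebra" for A a
    by (rule bounded) (auto simp: indicator_def abs_g)
  have inv: "distr \<mu> past_algebra shift = \<mu>"
  proof (rule measure_eqI)
    fix A assume "A \<in> sets (distr \<mu> past_algebra shift)"
    then have A [measurable]: "A \<in> sets past_algebra" by simp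
    have "shift -` A \<in> sets past_algebra"
      using measurable_sets[OF shift_measurable A] by simp
    then have "measure \<mu> (shift -` A) = (\<Sum>a\<in>UNIV. \<integral>x. g (append_symbol x a) * indicator A x \<partial>\<mu>)"
      by (simp add: fixed'[symmetric] indicator_vimage)
    also have "\<dots> = (\<integral>x. (\<Sum>a\<in>UNIV. g (append_symbol x a) * indicator A x) \<partial>\<mu>)"
      by (intro Bochner_Integration.integral_sum[symmetric] int A)
    also have "\<dots> = (\<integral>x. indicator A x \<partial>\<mu>)"
      by (simp add: sum_distrib_right[symmetric] g_function_sum[OF g])
    finally show "emeasure (distr \<mu> past_algebra shift) A = emeasure \<mu> A"
      by (simp add: emeasure_distr emeasure_eq_measure)
  qed (simp add: sets)
  define F where "F = vimage_algebra UNIV shift (past_algebra :: 'a past measure)"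
  have sub: "subalgebra \<mu> F"
  proof -
    have "sets F \<subseteq> sets past_algebra"
      unfolding F_def by (auto simp: sets_vimage_algebra2 intro: measurable_sets[OF shift_measurable, simplified])
    then show ?thesis by (simp add: subalgebra_def sets) (simp add: F_def)
  qed
  interpret finite_measure_subalgebra \<mu> F by standard (rule sub)
  have "AE x in \<mu>. real_cond_exp \<mu> F (indicator {y. y 0 = a}) x = g (append_symbol (shift x) a)" for a
  proof (rule real_cond_exp_charact)
    have ev [measurable]: "{y. y 0 = a} \<in> sets (past_algebra :: 'a past measure)"
      by (rule cylindrical_in_sets[of 1]) (auto simp: cylindrical_def cylinder_def)
    show "integrable \<mu> (indicator {y. y 0 = a} :: _ \<Rightarrow> real)"
      by (rule bounded) (auto simp: indicator_def)
    show "integrable \<mu> (\<lambda>x. g (append_symbol (shift x) a))"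
      by (rule bounded) (auto simp: abs_g)
    have "shift \<in> measurable F past_algebra"
      unfolding F_def by (rule measurable_vimage_algebra1) simp
    then show "(\<lambda>x. g (append_symbol (shift x) a)) \<in> borel_measurable F"
      by measurable
    fix A assume "A \<in> sets F"
    then obtain B where B [measurable]: "B \<in> sets past_algebra" and A: "A = shift -` B"
      by (auto simp: F_def sets_vimage_algebra2)
    have Am [measurable]: "A \<in> sets past_algebra"
      unfolding A using measurable_sets[OF shift_measurable B] by simp
    have "(\<integral>x\<in>A. indicator {y. y 0 = a} x \<partial>\<mu>) = measure \<mu> (A \<inter> {y. y 0 = a})"
      by (simp add: set_lebesgue_integral_def indicator_inter_arith[symmetric])
    also have "\<dots> = (\<Sum>b\<in>UNIV. \<integral>x. g (append_symbol x b) * indicator (A \<inter> {y. y 0 = a}) (append_symbol x b) \<partial>\<mu>)"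
      by (simp add: fixed')
    \<comment> \<open>The sequence \<open>append_symbol x b\<close> lies in \<open>A\<close> and has
      last symbol \<open>a\<close> exactly when \<open>x \<in> B\<close> and
      \<open>b = a\<close>.\<close>
    also have "\<dots> = (\<Sum>b\<in>UNIV. if b = a then \<integral>x. g (append_symbol x a) * indicator B x \<partial>\<mu> else 0)"
      by (intro sum.cong refl) (auto simp: A indicator_def intro!: Bochner_Integration.integral_cong)
    \<comment> \<open>The invariance just proved replaces \<open>x\<close> by
      \<open>shift x\<close>, which turns the integrand into an \<open>F\<close>-measurable
      function.\<close>
    also have "\<dots> = (\<integral>x. g (append_symbol x a) * indicator B x \<partial>distr \<mu> past_algebra shift)"
      by (simp add: inv)
    also have "\<dots> = (\<integral>x. g (append_symbol (shift x) a) * indicator B (shift x) \<partial>\<mu>)"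
      by (intro integral_distr) measurable
    also have "\<dots> = (\<integral>x\<in>A. g (append_symbol (shift x) a) \<partial>\<mu>)"
      unfolding set_lebesgue_integral_def A
      by (intro Bochner_Integration.integral_cong) (auto simp: indicator_def)
    finally show "(\<integral>x\<in>A. indicator {y. y 0 = a} x \<partial>\<mu>) = (\<integral>x\<in>A. g (append_symbol (shift x) a) \<partial>\<mu>)" .
  qed
  then have "AE x in \<mu>. \<forall>a. real_cond_exp \<mu> F (indicator {y. y 0 = a}) x = g (append_symbol (shift x) a)"
    by (simp add: AE_all_countable)
  then show ?thesis
    unfolding g_measure_def F_def using \<open>prob_space \<mu>\<close> sets inv by blast
qed

subsection \<open>Invariance of the limit measure\<close>

text \<open>A point \<open>y\<close> close to \<open>shift w\<close> is lifted by appending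
  \<open>w 0\<close>: agreement below \<open>n\<close> becomes agreement with \<open>w\<close> below
  \<open>Suc n\<close>. This is why the level drops by one.\<close>

lemma cylindrical_shift_hull: "cylindrical n (shift ` cylinder_hull (Suc n) S)"
  unfolding cylindrical_def
proof (intro ballI subsetI)
  fix x y assume "x \<in> shift ` cylinder_hull (Suc n) S" and y: "y \<in> cylinder n x"
  then obtain w where w: "w \<in> cylinder_hull (Suc n) S" and x: "x = shift w" by blast
  have "append_symbol y (w 0) \<in> cylinder (Suc n) w"
    using mem_cylinder_append[OF y, of "w 0"] by (simp add: x append_shift)
  then have "append_symbol y (w 0) \<in> cylinder_hull (Suc n) S"
    using cylindrical_hull w unfolding cylindrical_def by blast
  from imageI[OF this, of shift] show "y \<in> shift ` cylinder_hull (Suc n) S" by simp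
qed

text \<open>A point \<open>y\<close> of the shifted hull extends by one symbol to a point
  \<open>w\<close> of the hull. As \<open>N \<le> n\<close>, this \<open>w\<close> lies in
  \<open>E_set g N\<close>, so one summand of the nonnegative sum on the right is already at least
  \<open>e\<close>.\<close>

lemma indicator_shift_hull_le:
  assumes g: "g_function g" and e: "0 < e" "\<And>x. x \<in> E_set g N \<Longrightarrow> e \<le> g x" and "N \<le> n"
  shows "indicator (shift ` cylinder_hull (Suc n) (discontinuities g)) y
    \<le> 1 / e * transfer g (indicator (cylinder_hull (Suc n) (discontinuities g))) y"
    (is "indicator (shift ` ?H) y \<le> _")
proof (cases "y \<in> shift ` ?H")
  case True
  then obtain w where w: "w \<in> ?H" and y: "y = shift w" by blast
  have "w \<in> cylinder_hull (Suc N) (discontinuities g)"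
    using w cylinder_antimono[of "Suc N" "Suc n"] \<open>N \<le> n\<close> by (auto simp: cylinder_hull_def)
  then have "e \<le> g w" by (intro e) (simp add: E_set_def)
  also have "\<dots> = g (append_symbol y (w 0)) * indicator ?H (append_symbol y (w 0))"
    using w by (simp add: y append_shift)
  also have "\<dots> \<le> transfer g (indicator ?H) y"
    unfolding transfer_def by (rule member_le_sum) (simp_all add: g_function_nonneg[OF g])
  finally show ?thesis using e(1) True by simp
next
  case False
  have "0 \<le> transfer g (indicator ?H) y"
    unfolding transfer_def by (intro sum_nonneg mult_nonneg_nonneg g_function_nonneg[OF g]) simp
  then show ?thesis using e(1) False by simp
qed

text \<open>Agreement up to \<open>m\<close> freezes the indicator, and agreement up to
  \<open>n a\<close> controls \<open>g\<close> near \<open>append_symbol x a\<close>. The finite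
  alphabet allows one common \<open>k\<close>, and errors of \<open>d / ?c\<close> per symbol add up
  to \<open>d\<close>.\<close>

lemma transfer_indicator_continuous:
  fixes g :: "'a::finite past \<Rightarrow> real"
  assumes A: "cylindrical m A" and x: "\<And>a. append_symbol x a \<notin> discontinuities g" and "0 < d"
  shows "\<exists>k. \<forall>w\<in>cylinder k x. \<bar>transfer g (indicator A) w - transfer g (indicator A) x\<bar> \<le> d"
proof -
  let ?c = "real (CARD('a))"
  have "\<exists>n. \<forall>w\<in>cylinder n (append_symbol x a). \<bar>g w - g (append_symbol x a)\<bar> < d / ?c" for a
    using x[of a] \<open>0 < d\<close> unfolding notin_discontinuities_iff by simp
  then obtain n where n: "\<And>a w. w \<in> cylinder (n a) (append_symbol x a) \<Longrightarrow>
      \<bar>g w - g (append_symbol x a)\<bar> < d / ?c"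
    by metis
  define k where "k = Max (insert m (range n))"
  have k: "m \<le> k" "n a \<le> k" for a
    unfolding k_def by (rule Max_ge; simp)+
  have "\<bar>transfer g (indicator A) w - transfer g (indicator A) x\<bar> \<le> d" if w: "w \<in> cylinder k x" for w
  proof -
    have near: "append_symbol w a \<in> cylinder j (append_symbol x a)" if "j \<le> k" for a j
      using mem_cylinder_append[OF w, of a] cylinder_antimono[of j "Suc k" "append_symbol x a"] that by auto
    have "indicator A (append_symbol w a) = (indicator A (append_symbol x a) :: real)" for a
    proof -
      have "append_symbol w a \<in> A \<longleftrightarrow> append_symbol x a \<in> A"
        using near[OF k(1), of a] near[OF k(1), of a, unfolded mem_cylinder_sym[of "append_symbol w a"]] A
        unfolding cylindrical_def by blast
      then show ?thesis by (simp add: indicator_def)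
    qed
    then have "\<bar>transfer g (indicator A) w - transfer g (indicator A) x\<bar>
        = \<bar>\<Sum>a\<in>UNIV. (g (append_symbol w a) - g (append_symbol x a)) * indicator A (append_symbol x a)\<bar>"
      by (simp add: transfer_def sum_subtractf left_diff_distrib)
    also have "\<dots> \<le> (\<Sum>a\<in>UNIV. \<bar>(g (append_symbol w a) - g (append_symbol x a)) * indicator A (append_symbol x a)\<bar>)"
      by (rule sum_abs)
    also have "\<dots> \<le> (\<Sum>a\<in>(UNIV::'a set). d / ?c)"
    proof (rule sum_mono)
      fix a
      have "\<bar>g (append_symbol w a) - g (append_symbol x a)\<bar> \<le> d / ?c"
        using n[OF near[OF k(2)], of a] by simp
      then show "\<bar>(g (append_symbol w a) - g (append_symbol x a)) * indicator A (append_symbol x a)\<bar> \<le> d / ?c"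
        using \<open>0 < d\<close> by (simp add: indicator_def)
    qed
    also have "\<dots> = d" by simp
    finally show ?thesis .
  qed
  then show ?thesis by blast
qed

text \<open>A compactness argument off the clopen set \<open>?U\<close>: the sets \<open>K j\<close>
  of bad points decrease, are cylindrical and have empty intersection by pointwise continuity, so
  one of them is empty.\<close>

lemma transfer_indicator_uniformly_continuous:
  fixes g :: "'a::finite past \<Rightarrow> real"
  assumes A: "cylindrical m A" and "0 < d"
  obtains k where "n \<le> k"
    "\<And>x w. x \<notin> shift ` cylinder_hull (Suc n) (discontinuities g) \<Longrightarrow> w \<in> cylinder k x \<Longrightarrow>
      \<bar>transfer g (indicator A) w - transfer g (indicator A) x\<bar> \<le> d"
proof -
  let ?U = "shift ` cylinder_hull (Suc n) (discontinuities g)"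
  let ?h = "transfer g (indicator A)"
  \<comment> \<open>Starting the levels at \<open>n\<close> makes \<open>?U\<close>, and hence
    \<open>K j\<close>, cylindrical at level \<open>n + j\<close>.\<close>
  define K where "K j = {x. x \<notin> ?U \<and> (\<exists>w\<in>cylinder (n + j) x. \<exists>z\<in>cylinder (n + j) x. d < \<bar>?h w - ?h z\<bar>)}" for j
  have "cylindrical (n + j) (K j)" for j
    unfolding cylindrical_def
  proof (intro ballI subsetI)
    fix x w assume x: "x \<in> K j" and w: "w \<in> cylinder (n + j) x"
    have "cylindrical (n + j) (- ?U)"
      by (rule cylindrical_mono[OF cylindrical_Compl[OF cylindrical_shift_hull]]) simp
    then have "w \<in> - ?U" using x w unfolding cylindrical_def K_def by blast
    then show "w \<in> K j" using x unfolding K_def mem_Collect_eq cylinder_eq[OF w] by simp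
  qed
  then have "K j \<in> cylindrical_sets" for j by (rule cylindrical_sets_I)
  moreover have "decseq K"
    unfolding decseq_def
  proof (intro allI impI)
    fix i j :: nat assume "i \<le> j"
    then have "cylinder (n + j) x \<subseteq> cylinder (n + i) x" for x :: "'a past"
      by (intro cylinder_antimono) simp
    then show "K j \<subseteq> K i" unfolding K_def by blast
  qed
  moreover have "(\<Inter>j. K j) = {}"
  proof (rule equals0I)
    fix x assume x: "x \<in> (\<Inter>j. K j)"
    have "append_symbol x a \<notin> discontinuities g" for a
    proof
      assume "append_symbol x a \<in> discontinuities g"
      then have "append_symbol x a \<in> cylinder_hull (Suc n) (discontinuities g)"
        using mem_cylinder_self unfolding cylinder_hull_def by blast
      from imageI[OF this, of shift] have "x \<in> ?U" by simp
      moreover have "x \<in> K 0" using x by blast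
      ultimately show False unfolding K_def by blast
    qed
    then obtain k where k: "\<And>w. w \<in> cylinder k x \<Longrightarrow> \<bar>?h w - ?h x\<bar> \<le> d / 2"
      using transfer_indicator_continuous[OF A, of x g "d / 2"] \<open>0 < d\<close> by auto
    have "x \<in> K k" using x by blast
    then obtain w z where wz: "w \<in> cylinder (n + k) x" "z \<in> cylinder (n + k) x" "d < \<bar>?h w - ?h z\<bar>"
      unfolding K_def by blast
    have "w \<in> cylinder k x" "z \<in> cylinder k x"
      using wz(1,2) cylinder_antimono[of k "n + k" x] by auto
    from k[OF this(1)] k[OF this(2)] wz(3) show False by linarith
  qed
  ultimately obtain j where j: "K j = {}" by (rule decseq_cylindrical_empty)
  show thesis
  proof (rule that[of "n + j"])
    fix x w assume x: "x \<notin> ?U" and w: "w \<in> cylinder (n + j) x"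
    have "x \<notin> K j" using j by simp
    then show "\<bar>?h w - ?h x\<bar> \<le> d" using x w mem_cylinder_self[of x "n + j"]
      unfolding K_def mem_Collect_eq not_le[symmetric] by blast
  qed simp
qed

text \<open>The approximant is constant on \<open>k\<close>-cylinders: a sampled value on those
  disjoint from \<open>U\<close>, and zero on \<open>U\<close>. Uniform continuity bounds the error
  by \<open>d\<close> off \<open>U\<close>; on \<open>U\<close> the error is at most
  \<open>1\<close>, which the indicator absorbs.\<close>

lemma transfer_indicator_approx:
  fixes g :: "'a::finite past \<Rightarrow> real" and n :: nat
  assumes g: "g_function g" and A: "cylindrical m A" and "0 < d"
  defines "U \<equiv> shift ` cylinder_hull (Suc n) (discontinuities g)"
  obtains \<B> c where "finite \<B>" "\<B> \<subseteq> cylindrical_sets"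
    "\<And>x. \<bar>transfer g (indicator A) x - (\<Sum>B\<in>\<B>. c B * indicator B x)\<bar> \<le> d + indicator U x"
proof -
  let ?h = "transfer g (indicator A)"
  obtain k where "n \<le> k" and k: "\<And>x w. x \<notin> U \<Longrightarrow> w \<in> cylinder k x \<Longrightarrow> \<bar>?h w - ?h x\<bar> \<le> d"
    using transfer_indicator_uniformly_continuous[OF A \<open>0 < d\<close>, of n g] unfolding U_def by blast
  have U: "cylindrical k U"
    unfolding U_def using cylindrical_mono[OF cylindrical_shift_hull \<open>n \<le> k\<close>] .
  define \<B> where "\<B> = {B \<in> cylinders k. B \<inter> U = {}}"
  define c where "c B = ?h (SOME y. y \<in> B)" for B
  have fin: "finite \<B>" by (simp add: \<B>_def finite_cylinders)
  have sum_eq: "(\<Sum>B\<in>\<B>. c B * indicator B x) = (if cylinder k x \<in> \<B> then c (cylinder k x) else 0)" for x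
  proof -
    have "x \<in> B \<longleftrightarrow> B = cylinder k x" if "B \<in> \<B>" for B
      using that cylinder_eq[of x k] unfolding \<B>_def cylinders_def by auto
    then have "(\<Sum>B\<in>\<B>. c B * indicator B x) = (\<Sum>B\<in>\<B>. if B = cylinder k x then c B else 0)"
      by (intro sum.cong refl) (auto simp: indicator_def)
    then show ?thesis by (simp add: sum.delta fin)
  qed
  show thesis
  proof (rule that[of \<B> c])
    show "\<B> \<subseteq> cylindrical_sets"
      using cylindrical_sets_I[OF cylindrical_cylinder] by (auto simp: \<B>_def cylinders_def)
    fix x
    show "\<bar>?h x - (\<Sum>B\<in>\<B>. c B * indicator B x)\<bar> \<le> d + indicator U x"
    proof (cases "x \<in> U")
      case True
      then have "cylinder k x \<notin> \<B>" using mem_cylinder_self unfolding \<B>_def by blast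
      moreover have "\<bar>?h x\<bar> \<le> 1"
        using funpow_transfer_bounds[OF g, of 0 "indicator A" 1 1 x] by (simp add: indicator_def)
      ultimately show ?thesis using True \<open>0 < d\<close> by (simp add: sum_eq)
    next
      case False
      have "x \<in> - U" using False by simp
      then have "cylinder k x \<subseteq> - U"
        using cylindrical_Compl[OF U] unfolding cylindrical_def by blast
      then have "cylinder k x \<in> \<B>" unfolding \<B>_def cylinders_def by blast
      moreover have "(SOME y. y \<in> cylinder k x) \<in> cylinder k x"
        by (rule someI[of _ x]) simp
      then have "\<bar>c (cylinder k x) - ?h x\<bar> \<le> d" unfolding c_def by (rule k[OF False])
      ultimately show ?thesis using False by (simp add: sum_eq abs_minus_commute)
    qed
  qed (rule fin)
qed

section \<open>Passing from Cesaro means to the limit measure\<close>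

locale cesaro_limit = prob_space \<mu> for \<mu> :: "'a::finite past measure" +
  fixes g :: "'a past \<Rightarrow> real" and x :: "'a past" and r :: "nat \<Rightarrow> nat"
  assumes g: "g_function g"
    and sets_\<mu>: "sets \<mu> = sets past_algebra"
    and r: "strict_mono r"
    and limit: "\<And>A. A \<in> cylindrical_sets \<Longrightarrow> (\<lambda>n. cesaro g x (r n) (indicator A)) \<longlonglongrightarrow> measure \<mu> A"
begin

abbreviation D where "D \<equiv> discontinuities g"

text \<open>Cesaro means are asymptotically unchanged by the operator. For \<open>k = 1\<close> this
  is not yet invariance of \<mu>: the transferred indicator may be discontinuous, and its integral
  must still be identified with the limit.\<close>

lemma limit_funpow_transfer:
  assumes "A \<in> cylindrical_sets"
  shows "(\<lambda>n. cesaro g x (r n) ((transfer g ^^ k) (indicator A))) \<longlonglongrightarrow> measure \<mu> A"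
proof -
  have "(\<lambda>n. cesaro g x n ((transfer g ^^ k) (indicator A)) - cesaro g x n (indicator A)) \<longlonglongrightarrow> 0"
    by (rule cesaro_funpow_transfer[OF g]) simp_all
  from tendsto_add[OF LIMSEQ_subseq_LIMSEQ[OF this r] limit[OF assms]]
  show ?thesis by (simp add: o_def)
qed

lemma eventually_r_pos: "\<forall>\<^sub>F n in sequentially. 0 < r n"
  using eventually_gt_at_top[of 0] by eventually_elim (meson seq_suble[OF r] less_le_trans)

text \<open>The bound \<open>funpow_transfer_hull_le\<close> is uniform in the base point, so it
  survives averaging and the limit.\<close>

lemma measure_hull_le: "measure \<mu> (cylinder_hull n S) \<le> cylinder_mass g S n"
proof (rule tendsto_upperbound)
  show "(\<lambda>i. cesaro g x (r i) ((transfer g ^^ n) (indicator (cylinder_hull n S)))) \<longlonglongrightarrow> measure \<mu> (cylinder_hull n S)"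
    by (intro limit_funpow_transfer cylindrical_sets_I[OF cylindrical_hull])
  show "\<forall>\<^sub>F i in sequentially. cesaro g x (r i) ((transfer g ^^ n) (indicator (cylinder_hull n S))) \<le> cylinder_mass g S n"
    using eventually_r_pos
  proof eventually_elim
    case (elim i)
    have "cesaro g x (r i) ((transfer g ^^ n) (indicator (cylinder_hull n S))) \<le> cesaro g x (r i) (\<lambda>_. cylinder_mass g S n)"
      by (rule cesaro_mono[OF g funpow_transfer_hull_le[OF g]])
    then show ?case using cesaro_const[OF g elim] by simp
  qed
qed simp

lemma null_discontinuities:
  assumes "pressure g D < 0"
  shows "D \<in> null_sets \<mu>"
proof -
  have D: "D \<in> sets \<mu>" by (simp add: sets_\<mu> discontinuities_sets)
  have "measure \<mu> D \<le> cylinder_mass g D n" for n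
  proof -
    have "D \<subseteq> cylinder_hull n D" using mem_cylinder_self unfolding cylinder_hull_def by blast
    then have "measure \<mu> D \<le> measure \<mu> (cylinder_hull n D)"
      by (rule finite_measure_mono) (simp add: sets_\<mu> cylindrical_in_sets[OF cylindrical_hull])
    also note measure_hull_le
    finally show ?thesis .
  qed
  then have "measure \<mu> D \<le> 0"
    by (intro LIMSEQ_le_const[OF cylinder_mass_tendsto_0[OF g assms]]) simp
  then have "emeasure \<mu> D = 0" by (simp add: emeasure_eq_measure measure_le_0_iff)
  then show ?thesis using D by (rule null_setsI)
qed

text \<open>Averaging \<open>indicator_shift_hull_le\<close> and letting the averages converge turns
  the operator on the right into the measure of the hull.\<close>

lemma measure_shift_hull_le:
  assumes e: "0 < e" "\<And>x. x \<in> E_set g N \<Longrightarrow> e \<le> g x" and "N \<le> n"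
  shows "measure \<mu> (shift ` cylinder_hull (Suc n) D) \<le> cylinder_mass g D (Suc n) / e"
proof -
  let ?H = "cylinder_hull (Suc n) D"
  have "measure \<mu> (shift ` ?H) \<le> 1 / e * measure \<mu> ?H"
  proof (rule tendsto_le[OF _ _ limit])
    show "(\<lambda>i. 1 / e * cesaro g x (r i) (transfer g (indicator ?H))) \<longlonglongrightarrow> 1 / e * measure \<mu> ?H"
      using limit_funpow_transfer[OF cylindrical_sets_I[OF cylindrical_hull], of 1] by (intro tendsto_mult_left) simp
    show "\<forall>\<^sub>F i in sequentially. cesaro g x (r i) (indicator (shift ` ?H)) \<le> 1 / e * cesaro g x (r i) (transfer g (indicator ?H))"
      unfolding cesaro_cmult[symmetric]
      by (intro always_eventually allI cesaro_mono g indicator_shift_hull_le[OF g e \<open>N \<le> n\<close>])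
  qed (auto intro: cylindrical_sets_I[OF cylindrical_shift_hull])
  also have "\<dots> \<le> 1 / e * cylinder_mass g D (Suc n)"
    using e(1) by (intro mult_left_mono measure_hull_le) simp
  finally show ?thesis by simp
qed

lemma integrable_bounded:
  "f \<in> borel_measurable past_algebra \<Longrightarrow> (\<And>x. \<bar>f x\<bar> \<le> b) \<Longrightarrow> integrable \<mu> (f :: _ \<Rightarrow> real)"
  by (rule integrable_const_bound[where B=b]) (auto simp: measurable_cong_sets[OF sets_\<mu> refl])

text \<open>Both quantities are compared with the integral \<open>?s\<close> of a cylindrical
  approximant, one through Cesaro limits and the other by direct integration. Each comparison costs
  \<open>d + measure \<mu> (U n)\<close>.\<close>

lemma integral_transfer_close:
  assumes A: "A \<in> cylindrical_sets" and "0 < d"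
  defines "U \<equiv> \<lambda>n. shift ` cylinder_hull (Suc n) D"
  shows "\<bar>(\<integral>x. transfer g (indicator A) x \<partial>\<mu>) - measure \<mu> A\<bar> \<le> 2 * d + 2 * measure \<mu> (U n)"
proof -
  let ?h = "transfer g (indicator A)"
  obtain m where m: "cylindrical m A" using A by (auto simp: cylindrical_sets_def)
  obtain \<B> c where \<B>: "finite \<B>" "\<B> \<subseteq> cylindrical_sets"
    and close: "\<And>x. \<bar>?h x - (\<Sum>B\<in>\<B>. c B * indicator B x)\<bar> \<le> d + indicator (U n) x"
    using transfer_indicator_approx[OF g m \<open>0 < d\<close>, of n] unfolding U_def by blast
  let ?f = "\<lambda>x. \<Sum>B\<in>\<B>. c B * indicator B x"
  let ?s = "\<Sum>B\<in>\<B>. c B * measure \<mu> B"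
  have U: "U n \<in> cylindrical_sets" unfolding U_def by (rule cylindrical_sets_I[OF cylindrical_shift_hull])
  have cyl_sets: "B \<in> sets \<mu>" if "B \<in> cylindrical_sets" for B
    using that by (simp add: sets_\<mu> sets_past_algebra)
  have f_lim: "(\<lambda>i. cesaro g x (r i) ?f) \<longlonglongrightarrow> ?s"
    unfolding cesaro_sum using \<B>(2) by (intro tendsto_sum tendsto_mult_left limit) auto
  have h_lim: "(\<lambda>i. cesaro g x (r i) ?h) \<longlonglongrightarrow> measure \<mu> A"
    using limit_funpow_transfer[OF A, of 1] by simp
  have bound_lim: "(\<lambda>i. d + cesaro g x (r i) (indicator (U n))) \<longlonglongrightarrow> d + measure \<mu> (U n)"
    by (intro tendsto_add tendsto_const limit U)
  have "\<bar>measure \<mu> A - ?s\<bar> \<le> d + measure \<mu> (U n)"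
  proof (rule tendsto_le[OF _ bound_lim tendsto_rabs[OF tendsto_diff[OF h_lim f_lim]]])
    show "\<forall>\<^sub>F i in sequentially. \<bar>cesaro g x (r i) ?h - cesaro g x (r i) ?f\<bar> \<le> d + cesaro g x (r i) (indicator (U n))"
      using eventually_r_pos
    proof eventually_elim
      case (elim i)
      have b: "cesaro g x (r i) (\<lambda>x. d + indicator (U n) x) = d + cesaro g x (r i) (indicator (U n))"
        by (simp only: cesaro_add cesaro_const[OF g elim])
      \<comment> \<open>The estimate is split into two one-sided inequalities, to which monotonicity
        and additivity of the means apply.\<close>
      have "?h y \<le> ?f y + (d + indicator (U n) y)" "?f y \<le> ?h y + (d + indicator (U n) y)" for y
        using close[of y] by (simp_all add: abs_le_iff)
      from cesaro_mono[where f="?h" and x=x and n="r i", OF g this(1)]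
        cesaro_mono[where f="?f" and x=x and n="r i", OF g this(2)]
      show ?case unfolding cesaro_add[of g x "r i" ?f] cesaro_add[of g x "r i" ?h] b
        by (simp add: abs_le_iff)
    qed
  qed simp
  moreover have "\<bar>(\<integral>x. ?h x \<partial>\<mu>) - ?s\<bar> \<le> d + measure \<mu> (U n)"
  proof -
    note [measurable] = g_function_measurable[OF g] cylindrical_in_sets[OF m]
    have h_int: "integrable \<mu> ?h"
    proof (rule integrable_bounded)
      show "?h \<in> borel_measurable past_algebra" unfolding transfer_def[abs_def] by measurable
      show "\<bar>?h y\<bar> \<le> 1" for y
        using funpow_transfer_bounds[OF g, of 0 "indicator A" 1 1 y] by (simp add: indicator_def)
    qed
    have term_int: "integrable \<mu> (\<lambda>x. c B * indicator B x)" if "B \<in> \<B>" for B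
      using that \<B>(2) cyl_sets by (intro integrable_mult_right integrable_real_indicator) (auto simp: emeasure_eq_measure)
    have f_int: "integrable \<mu> ?f"
      by (intro Bochner_Integration.integrable_sum term_int)
    have "?s = (\<integral>x. ?f x \<partial>\<mu>)"
    proof -
      have "(\<integral>x. ?f x \<partial>\<mu>) = (\<Sum>B\<in>\<B>. \<integral>x. c B * indicator B x \<partial>\<mu>)"
        by (intro Bochner_Integration.integral_sum term_int)
      also have "\<dots> = ?s"
        using \<B>(2) sets_eq_imp_space_eq[OF sets_\<mu>] by (intro sum.cong refl) simp
      finally show ?thesis by simp
    qed
    then have "\<bar>(\<integral>x. ?h x \<partial>\<mu>) - ?s\<bar> = \<bar>\<integral>x. ?h x - ?f x \<partial>\<mu>\<bar>"
      using h_int f_int by simp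
    also have "\<dots> \<le> (\<integral>x. \<bar>?h x - ?f x\<bar> \<partial>\<mu>)" by (rule integral_abs_bound)
    also have "\<dots> \<le> (\<integral>x. d + indicator (U n) x \<partial>\<mu>)"
      using cyl_sets[OF U]
      by (intro Bochner_Integration.integral_mono close integrable_abs Bochner_Integration.integrable_diff h_int f_int
          Bochner_Integration.integrable_add integrable_real_indicator) (auto simp: emeasure_eq_measure)
    also have "\<dots> = d + measure \<mu> (U n)"
      using cyl_sets[OF U] sets_eq_imp_space_eq[OF sets_\<mu>] prob_space
      by (subst Bochner_Integration.integral_add) (auto simp: emeasure_eq_measure)
    finally show ?thesis .
  qed
  ultimately show ?thesis by linarith
qed

text \<open>First \<open>n\<close> tends to infinity, which removes the mass of the shifted hull;
  then \<open>d\<close> is made small.\<close>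

lemma integral_transfer:
  assumes e: "0 < e" "\<And>x. x \<in> E_set g N \<Longrightarrow> e \<le> g x" and p: "pressure g D < 0"
    and A: "A \<in> cylindrical_sets"
  shows "(\<integral>x. transfer g (indicator A) x \<partial>\<mu>) = measure \<mu> A"
proof -
  let ?\<Delta> = "\<bar>(\<integral>x. transfer g (indicator A) x \<partial>\<mu>) - measure \<mu> A\<bar>"
  have "?\<Delta> \<le> 2 * d" if "0 < d" for d
  proof (rule LIMSEQ_le_const)
    have "(\<lambda>n. 2 * d + 2 * (cylinder_mass g D (Suc n) / e)) \<longlonglongrightarrow> 2 * d + 2 * (0 / e)"
      using e(1) by (intro tendsto_intros LIMSEQ_Suc cylinder_mass_tendsto_0 g p) simp
    then show "(\<lambda>n. 2 * d + 2 * (cylinder_mass g D (Suc n) / e)) \<longlonglongrightarrow> 2 * d" by simp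
    have "?\<Delta> \<le> 2 * d + 2 * (cylinder_mass g D (Suc n) / e)" if "N \<le> n" for n
      using integral_transfer_close[OF A \<open>0 < d\<close>, of n] measure_shift_hull_le[OF e that] by linarith
    then show "\<exists>N. \<forall>n\<ge>N. ?\<Delta> \<le> 2 * d + 2 * (cylinder_mass g D (Suc n) / e)" by blast
  qed
  \<comment> \<open>With this \<open>d\<close> the bound reads
    \<open>?\<Delta> \<le> ?\<Delta> / 2\<close>, which excludes a positive
    \<open>?\<Delta>\<close>.\<close>
  from this[of "?\<Delta> / 4"] show ?thesis by (cases "?\<Delta> = 0") auto
qed

end

section \<open>Existence of a g-measure not charging the discontinuities\<close>

theorem theorem1:
  fixes g :: "'a::finite past \<Rightarrow> real" and N :: nat and \<epsilon> :: ereal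
  assumes "g_function g"
    and "\<epsilon> > 0" and "(INF x\<in>E_set g N. ereal (g x)) = \<epsilon>"
    and "pressure g (discontinuities g) < 0"
  shows "\<exists>\<mu>. g_measure g \<mu> \<and> discontinuities g \<in> null_sets \<mu>"
proof -
  \<comment> \<open>The infimum is \<infinity> when \<open>E_set g N\<close> is empty; a real
    \<open>e\<close> strictly below \<epsilon> covers this case as well.\<close>
  obtain e where e: "0 < ereal e" "ereal e < \<epsilon>"
    using ereal_dense2[OF assms(2)] by auto
  have e_le: "e \<le> g x" if "x \<in> E_set g N" for x
  proof -
    have "\<epsilon> \<le> ereal (g x)" unfolding assms(3)[symmetric] using that by (rule INF_lower)
    then have "ereal e < ereal (g x)" using e(2) by (rule less_le_trans[rotated])
    then show ?thesis by simp
  qed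
  \<comment> \<open>Any past can start the averages; \<open>undefined\<close> is merely some point
    of the space.\<close>
  obtain \<mu> r where \<mu>: "prob_space \<mu>" "sets \<mu> = sets past_algebra" "strict_mono r"
    "\<And>A. A \<in> cylindrical_sets \<Longrightarrow> (\<lambda>n. cesaro g undefined (r n) (indicator A)) \<longlonglongrightarrow> measure \<mu> A"
    using cesaro_limit_measure[OF assms(1), of undefined] by blast
  interpret cesaro_limit \<mu> g undefined r
    using \<mu> assms(1) by (intro cesaro_limit.intro cesaro_limit_axioms.intro)
  have "(\<integral>x. transfer g (indicator A) x \<partial>\<mu>) = measure \<mu> A" if "A \<in> cylindrical_sets" for A
    using integral_transfer[OF _ e_le assms(4) that] e(1) by simp
  then have "g_measure g \<mu>"
    by (rule g_measure_if_dual_fixed_point[OF assms(1) \<mu>(1,2)])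
  then show ?thesis using null_discontinuities[OF assms(4)] by blast
qed

end
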